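(* Let $k\ge 0$ and let $u,p,r,m,s$ (with values in $V_h^k$, depending on time $t$) be a solution of the semi-discrete LDG scheme for the modified Camassa--Holm equation described in the context, with periodic boundary conditions, where the fluxes $\hat f,\hat g$ are either the dissipative fluxes or the conservative fluxes. Then the scheme is conservative with respect to $m$, i.e. $$\frac{d}{dt}\int_\Omega m\,dx=0,$$ and the discrete energy $E(u,r)=\|u\|^2+\|r\|^2$ satisfies: (1) for the dissipative scheme, $\dfrac{d}{dt}E(u,r)\le 0$; (2) for the conservative scheme, $\dfrac{d}{dt}E(u,r)=0$.
   Context: Modified Camassa--Holm equation: $M_t+2\kappa^2U_x+((U^2-U_x^2)M)_x=0$, $M=U-U_{xx}$, with $\kappa\in\mathbb R$ constant and periodic boundary conditions on $\Omega=(x_l,x_r)$. With $R=U_x$, $P=(U^2R)_x$, $S=(\tfrac13R^3)_x$, $f(U)=2\kappa^2U+U^3$, $g(R)=\tfrac13R^3$, it is rewritten as $M_t+f(U)_x-P_x+(R^2U)_x+S_x=0$, $P-(U^2R)_x=0$, $R-U_x=0$, $M-U+R_x=0$, $S-g(R)_x=0$. Mesh and space: $\Omega$ is partitioned into cells $I_j=(x_{j-1/2},x_{j+1/2})$, $j=1,\dots,N$, $x_{1/2}=x_l$, $x_{N+1/2}=x_r$, $h_j=x_{j+1/2}-x_{j-1/2}$, $h=\max_jh_j$. The mesh is quasi-uniform: $h_j/h\ge\rho$ for a fixed $\rho>0$. $V_h^k=\{v\in L^2(\Omega): v|_{I_j}\in\mathcal P_k(I_j)\ \forall j\}$, where $\mathcal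 P_k(I_j)$ is the space of polynomials of degree at most $k$. $v^\pm_{j+1/2}$ are the right ($+$) and left ($-$) limits of $v$ at $x_{j+1/2}$, with periodic identification of the two end points; $\{v\}=\tfrac12(v^++v^-)$; $(w,v)_j=\int_{I_j}wv\,dx$; $\|\cdot\|$ is the $L^2(\Omega)$ norm. Scheme: for each $t$ find $u,p,r,m,s\in V_h^k$ such that for every $j$ and all $v,q,\psi,\varphi,w\in V_h^k$ $$(m_t,v)_j-(f(u),v_x)_j+\hat f_{j+1/2}v^-_{j+1/2}-\hat f_{j-1/2}v^+_{j-1/2}+(p,v_x)_j-\hat p_{j+1/2}v^-_{j+1/2}+\hat p_{j-1/2}v^+_{j-1/2}$$ $$-(r^2u,v_x)_j+\widehat{(r^2u)}_{j+1/2}v^-_{j+1/2}-\widehat{(r^2u)}_{j-1/2}v^+_{j-1/2}-(s,v_x)_j+\hat s_{j+1/2}v^-_{j+1/2}-\hat s_{j-1/2}v^+_{j-1/2}=0,$$ $$(p,q)_j+(u^2r,q_x)_j-\widehat{(u^2r)}_{j+1/2}q^-_{j+1/2}+\widehat{(u^2r)}_{j-1/2}q^+_{j-1/2}=0,$$ $$(r,\psi)_j+(u,\psi_x)_j-\hat u_{j+1/2}\psi^-_{j+1/2}+\hat u_{j-1/2}\psi^+_{j-1/2}=0,$$ $$(m,\varphi)_j-(u,\varphi)_j-(r,\varphi_x)_j+\hat r_{j+1/2}\varphi^-_{j+1/2}-\hat r_{j-1/2}\varphi^+_{j-1/2}=0,$$ $$(s,w)_j+(g(r),w_x)_j-\hat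 g_{j+1/2}w^-_{j+1/2}+\hat g_{j-1/2}w^+_{j-1/2}=0,$$ with fluxes (at each interface) $\hat p=p^+$, $\widehat{(r^2u)}=\{ur\}r^+$, $\widehat{(u^2r)}=\{ur\}u^-$, $\hat u=u^-$, $\hat r=r^+$, $\hat s=s^+$. Dissipative scheme: $\hat f=f(u^-)$, $\hat g=g(r^+)$. Conservative scheme: $\hat f=\kappa^2(u^++u^-)+\tfrac14(u^++u^-)((u^+)^2+(u^-)^2)$, $\hat g=\tfrac1{12}(r^++r^-)((r^+)^2+(r^-)^2)$. *)

theory Defs
  imports "HOL-Analysis.Analysis" "HOL-Computational_Algebra.Polynomial"
begin

text \<open>
  Mesh. The interface written x_(i + 1/2) is the node \<open>x i\<close>, \<open>i = 0, ..., N\<close>, so that cell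
  \<open>j \<in> {1..N}\<close> is the open interval between the nodes \<open>j - 1\<close> and \<open>j\<close>.
\<close>

definition cell :: "(nat \<Rightarrow> real) \<Rightarrow> nat \<Rightarrow> real set" where
  "cell x j = {x (j - 1)<..<x j}"

definition cell_length :: "(nat \<Rightarrow> real) \<Rightarrow> nat \<Rightarrow> real" where
  "cell_length x j = x j - x (j - 1)"

definition mesh_size :: "(nat \<Rightarrow> real) \<Rightarrow> nat \<Rightarrow> real" where
  "mesh_size x N = Max (cell_length x ` {1..N})"

definition quasi_uniform_mesh ::
    "real \<Rightarrow> real \<Rightarrow> real \<Rightarrow> nat \<Rightarrow> (nat \<Rightarrow> real) \<Rightarrow> bool" where
  "quasi_uniform_mesh \<rho> xl xr N x \<longleftrightarrow>
     1 \<le> N \<and> x 0 = xl \<and> x N = xr \<and> strict_mono_on {0..N} x \<and>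
     0 < \<rho> \<and> (\<forall>j\<in>{1..N}. \<rho> \<le> cell_length x j / mesh_size x N)"

text \<open>
  The discontinuous finite element space. Its elements are functions, not classes modulo null
  sets; their values at the nodes (and outside the domain) are arbitrary and never used.
  Membership in L2 of the domain is automatic for finitely many polynomial pieces.
\<close>

definition dg_space :: "nat \<Rightarrow> nat \<Rightarrow> (nat \<Rightarrow> real) \<Rightarrow> (real \<Rightarrow> real) set" where
  "dg_space k N x =
     {v. \<forall>j\<in>{1..N}. \<exists>q :: real poly. degree q \<le> k \<and> (\<forall>y\<in>cell x j. v y = poly q y)}"

text \<open>
  One-sided limits at interface \<open>i \<in> {0..N}\<close>; the two end points are identified, so the left limit
  at node \<open>0\<close> is taken at node \<open>N\<close> and the right limit at node \<open>N\<close> is taken at node \<open>0\<close>.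
\<close>

definition tr_minus :: "nat \<Rightarrow> (nat \<Rightarrow> real) \<Rightarrow> (real \<Rightarrow> real) \<Rightarrow> nat \<Rightarrow> real" where
  "tr_minus N x v i = Lim (at_left (x (if i = 0 then N else i))) v"

definition tr_plus :: "nat \<Rightarrow> (nat \<Rightarrow> real) \<Rightarrow> (real \<Rightarrow> real) \<Rightarrow> nat \<Rightarrow> real" where
  "tr_plus N x v i = Lim (at_right (x (if i = N then 0 else i))) v"

definition avg :: "nat \<Rightarrow> (nat \<Rightarrow> real) \<Rightarrow> (real \<Rightarrow> real) \<Rightarrow> nat \<Rightarrow> real" where
  "avg N x v i = (tr_plus N x v i + tr_minus N x v i) / 2"

definition cell_inner :: "(nat \<Rightarrow> real) \<Rightarrow> nat \<Rightarrow> (real \<Rightarrow> real) \<Rightarrow> (real \<Rightarrow> real) \<Rightarrow> real" where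
  "cell_inner x j w v = (LBINT y:cell x j. w y * v y)"

definition l2_norm :: "real set \<Rightarrow> (real \<Rightarrow> real) \<Rightarrow> real" where
  "l2_norm A v = sqrt (LBINT y:A. (v y)\<^sup>2)"

text \<open>
  The weak form on cell \<open>j\<close> of the spatial derivative of \<open>F\<close> with numerical flux \<open>Fh\<close>:
  \<open>- (F, v_x)_j + Fh_(j+1/2) v^-_(j+1/2) - Fh_(j-1/2) v^+_(j-1/2)\<close>.
\<close>

definition dg_form ::
    "nat \<Rightarrow> (nat \<Rightarrow> real) \<Rightarrow> nat \<Rightarrow> (real \<Rightarrow> real) \<Rightarrow> (nat \<Rightarrow> real) \<Rightarrow> (real \<Rightarrow> real) \<Rightarrow> real" where
  "dg_form N x j F Fh v =
     - cell_inner x j F (deriv v) + Fh j * tr_minus N x v j - Fh (j - 1) * tr_plus N x v (j - 1)"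

definition mch_f :: "real \<Rightarrow> real \<Rightarrow> real" where
  "mch_f \<kappa> U = 2 * \<kappa>\<^sup>2 * U + U ^ 3"

definition mch_g :: "real \<Rightarrow> real" where
  "mch_g R = R ^ 3 / 3"

datatype scheme = Dissipative | Conservative

text \<open>The numerical fluxes for \<open>f\<close> and \<open>g\<close>, as functions of the left limit \<open>a\<close> and right limit \<open>b\<close>.\<close>

fun f_flux :: "scheme \<Rightarrow> real \<Rightarrow> real \<Rightarrow> real \<Rightarrow> real" where
  "f_flux Dissipative \<kappa> a b = mch_f \<kappa> a"
| "f_flux Conservative \<kappa> a b = \<kappa>\<^sup>2 * (b + a) + (b + a) * (b\<^sup>2 + a\<^sup>2) / 4"

fun g_flux :: "scheme \<Rightarrow> real \<Rightarrow> real \<Rightarrow> real" where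
  "g_flux Dissipative a b = mch_g b"
| "g_flux Conservative a b = (b + a) * (b\<^sup>2 + a\<^sup>2) / 12"

text \<open>
  The scheme at a fixed time for the spatial functions \<open>u, p, r, m, s\<close>, with \<open>mt\<close> in place of the
  time derivative of \<open>m\<close>.
\<close>

definition ldg_equations ::
    "scheme \<Rightarrow> real \<Rightarrow> nat \<Rightarrow> nat \<Rightarrow> (nat \<Rightarrow> real) \<Rightarrow> (real \<Rightarrow> real) \<Rightarrow> (real \<Rightarrow> real) \<Rightarrow>
     (real \<Rightarrow> real) \<Rightarrow> (real \<Rightarrow> real) \<Rightarrow> (real \<Rightarrow> real) \<Rightarrow> (real \<Rightarrow> real) \<Rightarrow> bool" where
  "ldg_equations sch \<kappa> k N x mt u p r m s \<longleftrightarrow>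
    (let
       V = dg_space k N x;
       ur = avg N x (\<lambda>y. u y * r y);
       f_hat = (\<lambda>i. f_flux sch \<kappa> (tr_minus N x u i) (tr_plus N x u i));
       g_hat = (\<lambda>i. g_flux sch (tr_minus N x r i) (tr_plus N x r i));
       p_hat = tr_plus N x p;
       r2u_hat = (\<lambda>i. ur i * tr_plus N x r i);
       u2r_hat = (\<lambda>i. ur i * tr_minus N x u i);
       u_hat = tr_minus N x u;
       r_hat = tr_plus N x r;
       s_hat = tr_plus N x s
     in
     \<forall>j\<in>{1..N}.
       (\<forall>v\<in>V. cell_inner x j mt v
           + dg_form N x j (\<lambda>y. mch_f \<kappa> (u y)) f_hat v
           - dg_form N x j p p_hat v
           + dg_form N x j (\<lambda>y. (r y)\<^sup>2 * u y) r2u_hat v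
           + dg_form N x j s s_hat v = 0) \<and>
       (\<forall>q\<in>V. cell_inner x j p q - dg_form N x j (\<lambda>y. (u y)\<^sup>2 * r y) u2r_hat q = 0) \<and>
       (\<forall>\<psi>\<in>V. cell_inner x j r \<psi> - dg_form N x j u u_hat \<psi> = 0) \<and>
       (\<forall>\<phi>\<in>V. cell_inner x j m \<phi> - cell_inner x j u \<phi> + dg_form N x j r r_hat \<phi> = 0) \<and>
       (\<forall>w\<in>V. cell_inner x j s w - dg_form N x j (\<lambda>y. mch_g (r y)) g_hat w = 0))"

text \<open>
  Solutions on a time interval \<open>J\<close>; time derivatives are taken within \<open>J\<close>, hence one-sided at end
  points belonging to \<open>J\<close>. Only \<open>m\<close> is differentiated in time by the scheme, so only \<open>m\<close> is required
  to be differentiable. As \<open>m\<close> takes values in a finite-dimensional space of piecewise polynomials,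
  differentiability at each point of the cells is the same as differentiability as a map into
  that space.
\<close>

definition ldg_solution ::
    "scheme \<Rightarrow> real \<Rightarrow> nat \<Rightarrow> nat \<Rightarrow> (nat \<Rightarrow> real) \<Rightarrow> real set \<Rightarrow>
     (real \<Rightarrow> real \<Rightarrow> real) \<Rightarrow> (real \<Rightarrow> real \<Rightarrow> real) \<Rightarrow> (real \<Rightarrow> real \<Rightarrow> real) \<Rightarrow>
     (real \<Rightarrow> real \<Rightarrow> real) \<Rightarrow> (real \<Rightarrow> real \<Rightarrow> real) \<Rightarrow> bool" where
  "ldg_solution sch \<kappa> k N x J u p r m s \<longleftrightarrow>
    (\<forall>t\<in>J.
       {u t, p t, r t, m t, s t} \<subseteq> dg_space k N x \<and>
       (\<forall>j\<in>{1..N}. \<forall>y\<in>cell x j. (\<lambda>\<tau>. m \<tau> y) differentiable (at t within J)) \<and>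
       ldg_equations sch \<kappa> k N x
         (\<lambda>y. vector_derivative (\<lambda>\<tau>. m \<tau> y) (at t within J)) (u t) (p t) (r t) (m t) (s t))"

definition energy :: "real set \<Rightarrow> (real \<Rightarrow> real) \<Rightarrow> (real \<Rightarrow> real) \<Rightarrow> real" where
  "energy \<Omega> u r = (l2_norm \<Omega> u)\<^sup>2 + (l2_norm \<Omega> r)\<^sup>2"

end

theory Submission
  imports Defs
begin

text \<open>
  The two one-sided discrete derivatives with fluxes \<open>u^-\<close> and \<open>r^+\<close> are negative adjoints of each
  other, so the equations for \<open>r\<close> and \<open>m\<close> give
  \<open>(m(\<sigma>), u(\<tau>)) = (u(\<sigma>), u(\<tau>)) + (r(\<sigma>), r(\<tau>))\<close> for all times \<open>\<sigma>, \<tau>\<close>. In particular the energy is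
  \<open>(m, u)\<close>. Only \<open>m\<close> is assumed differentiable in time, but by the symmetry of the right-hand side
  \<open>E(\<tau>) - E(t) - 2 (m(\<tau>) - m(t), u(t)) = \<parallel>u(\<tau>) - u(t)\<parallel>^2 + \<parallel>r(\<tau>) - r(t)\<parallel>^2\<close>, which lies between 0
  and \<open>\<parallel>m(\<tau>) - m(t)\<parallel>^2\<close>; hence \<open>E' = 2 (m_t, u)\<close>. Testing the evolution equation with \<open>u\<close>, the
  equations for \<open>p\<close> and \<open>s\<close> with \<open>r\<close>, and the equation for \<open>r\<close> with \<open>p\<close> and \<open>s\<close>, the mixed
  terms telescope, and what remains is a sum over the interfaces of entropy productions of the
  fluxes for \<open>f\<close> and \<open>g\<close>, which have a sign because the primitives of \<open>f\<close> and \<open>g\<close> are convex.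
\<close>

section \<open>Lagrange interpolation and a squeeze criterion for derivatives\<close>

lemma poly_lagrange_basis:
  fixes S :: "'a :: field set"
  assumes "finite S" "card S = Suc k"
  obtains L :: "'a \<Rightarrow> 'a poly"
  where "\<And>q. degree q \<le> k \<Longrightarrow> q = (\<Sum>i\<in>S. smult (poly q i) (L i))"
proof -
  define L where
    "L i = smult (inverse (\<Prod>l\<in>S-{i}. i - l)) (\<Prod>l\<in>S-{i}. [:-l, 1:])" for i
  have poly_L: "poly (L i) z = (if z = i then 1 else 0)" if "i \<in> S" "z \<in> S" for i z
    using that assms(1) by (auto simp: L_def poly_prod intro!: prod_zero)
  have degree_L: "degree (L i) \<le> k" if "i \<in> S" for i
  proof -
    have "degree (L i) \<le> degree (\<Prod>l\<in>S-{i}. [:-l, 1:])"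
      by (simp add: L_def)
    also have "\<dots> \<le> sum (degree \<circ> (\<lambda>l. [:-l, 1:])) (S-{i})"
      using assms(1) by (intro degree_prod_sum_le) auto
    also have "\<dots> = k"
      using assms that by simp
    finally show ?thesis .
  qed
  show thesis
  proof
    fix q :: "'a poly" assume q: "degree q \<le> k"
    show "q = (\<Sum>i\<in>S. smult (poly q i) (L i))"
    proof (rule poly_eqI_degree[of S])
      fix z assume z: "z \<in> S"
      have "poly (\<Sum>i\<in>S. smult (poly q i) (L i)) z = (\<Sum>i\<in>S. if i = z then poly q i else 0)"
        unfolding poly_sum using z by (intro sum.cong) (auto simp: poly_L)
      also have "\<dots> = poly q z"
        using z assms(1) by simp
      finally show "poly q z = poly (\<Sum>i\<in>S. smult (poly q i) (L i)) z" ..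
    next
      have "degree (\<Sum>i\<in>S. smult (poly q i) (L i)) \<le> k"
        by (intro degree_sum_le assms) (use degree_L in \<open>auto intro: order.trans[OF degree_smult_le]\<close>)
      then show "degree (\<Sum>i\<in>S. smult (poly q i) (L i)) < card S"
        using assms by simp
    qed (use q assms in auto)
  qed
qed

text \<open>Both functions vanish at \<open>t\<close>, so the difference quotient of
  \<open>f\<close> is dominated in absolute value by that of \<open>g\<close>. This yields a
  derivative for the remainder term of the energy, whose ingredients \<open>u\<close> and
  \<open>r\<close> are not known to be differentiable in time.\<close>

lemma has_real_derivative_zero_squeeze:
  fixes f g :: "real \<Rightarrow> real"
  assumes "(g has_real_derivative 0) (at t within J)" "t \<in> J" "g t = 0"
    and "\<And>\<tau>. \<tau> \<in> J \<Longrightarrow> 0 \<le> f \<tau> \<and> f \<tau> \<le> g \<tau>"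
  shows "(f has_real_derivative 0) (at t within J)"
proof -
  have "f t = 0"
    using assms(2-4) by force
  have "((\<lambda>\<tau>. \<bar>(g \<tau> - g t) / (\<tau> - t)\<bar>) \<longlongrightarrow> 0) (at t within J)"
    using assms(1) tendsto_rabs_zero by (simp only: has_field_derivative_iff)
  then have "((\<lambda>\<tau>. (f \<tau> - f t) / (\<tau> - t)) \<longlongrightarrow> 0) (at t within J)"
  proof (rule Lim_null_comparison[rotated])
    show "\<forall>\<^sub>F \<tau> in at t within J. norm ((f \<tau> - f t) / (\<tau> - t)) \<le> \<bar>(g \<tau> - g t) / (\<tau> - t)\<bar>"
      unfolding eventually_at_filter
      by (rule always_eventually)
        (use assms(4) in \<open>auto simp: \<open>f t = 0\<close> assms(3) abs_divide intro!: divide_right_mono\<close>,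
          metis abs_ge_self abs_of_nonneg order_trans)
  qed
  then show ?thesis
    by (simp add: has_field_derivative_iff)
qed

section \<open>Piecewise polynomials on the mesh and their integrals\<close>

locale dg_mesh =
  fixes N :: nat and x :: "nat \<Rightarrow> real"
  assumes N_pos: "1 \<le> N" and x_mono: "strict_mono_on {0..N} x"
begin

lemma x_less: "i < j \<Longrightarrow> j \<le> N \<Longrightarrow> x i < x j"
  using x_mono by (auto simp: strict_mono_on_def)

lemma x_le: "i \<le> j \<Longrightarrow> j \<le> N \<Longrightarrow> x i \<le> x j"
  using x_less[of i j] by (cases "i = j") auto

lemma cell_nonempty: "j \<in> {1..N} \<Longrightarrow> x (j - 1) < x j"
  by (intro x_less) auto

lemma open_cell [simp]: "open (cell x j)"
  by (simp add: cell_def)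

lemma sets_cell [simp]: "cell x j \<in> sets borel"
  by (simp add: cell_def)

text \<open>No degree bound is imposed: products such as \<open>(u y)\<^sup>2 * r y\<close> leave
  the discrete space, while integrability, one-sided limits and the fundamental theorem of calculus
  only need polynomial pieces. The class is closed under all operations that occur below.\<close>

definition pw_poly :: "(real \<Rightarrow> real) \<Rightarrow> bool" where
  "pw_poly v \<longleftrightarrow> (\<forall>j\<in>{1..N}. \<exists>q. \<forall>y\<in>cell x j. v y = poly q y)"

lemma pw_polyE:
  assumes "pw_poly v" "j \<in> {1..N}"
  obtains q where "\<And>y. y \<in> cell x j \<Longrightarrow> v y = poly q y"
  using assms unfolding pw_poly_def by blast

lemma dg_space_imp_pw_poly: "v \<in> dg_space k N x \<Longrightarrow> pw_poly v"
  by (force simp: dg_space_def pw_poly_def)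

lemma pw_poly_const [simp, intro]: "pw_poly (\<lambda>y. c)"
  unfolding pw_poly_def by (auto intro!: exI[of _ "[:c:]"])

lemma pw_poly_poly [simp, intro]: "pw_poly (poly q)"
  unfolding pw_poly_def by auto

lemma pw_poly_add [simp, intro]: "pw_poly v \<Longrightarrow> pw_poly w \<Longrightarrow> pw_poly (\<lambda>y. v y + w y)"
  unfolding pw_poly_def by (metis poly_add)

lemma pw_poly_mult [simp, intro]: "pw_poly v \<Longrightarrow> pw_poly w \<Longrightarrow> pw_poly (\<lambda>y. v y * w y)"
  unfolding pw_poly_def by (metis poly_mult)

lemma pw_poly_diff [simp, intro]: "pw_poly v \<Longrightarrow> pw_poly w \<Longrightarrow> pw_poly (\<lambda>y. v y - w y)"
  unfolding pw_poly_def by (metis poly_diff)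

lemma pw_poly_power [simp, intro]: "pw_poly v \<Longrightarrow> pw_poly (\<lambda>y. v y ^ n)"
  by (induction n) auto

lemma pw_poly_divide [simp, intro]: "pw_poly v \<Longrightarrow> pw_poly (\<lambda>y. v y / c)"
  using pw_poly_mult[of v "\<lambda>_. inverse c"] by (simp add: divide_inverse)

lemma DERIV_cell:
  assumes "\<And>y. y \<in> cell x j \<Longrightarrow> v y = poly q y" "y \<in> cell x j"
  shows "(v has_real_derivative poly (pderiv q) y) (at y)"
  by (rule has_field_derivative_transform_within_open[OF poly_DERIV open_cell assms(2)])
    (use assms(1) in auto)

lemma pw_poly_DERIV:
  assumes "pw_poly v" "j \<in> {1..N}" "y \<in> cell x j"
  shows "(v has_real_derivative deriv v y) (at y)"
  using pw_polyE[OF assms(1,2)] DERIV_cell[OF _ assms(3)] DERIV_imp_deriv by metis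

lemma pw_poly_deriv [simp, intro]: "pw_poly v \<Longrightarrow> pw_poly (deriv v)"
  unfolding pw_poly_def by (metis DERIV_cell DERIV_imp_deriv)

lemma set_integrable_cell:
  assumes "pw_poly v" "j \<in> {1..N}"
  shows "set_integrable lborel (cell x j) v"
proof -
  obtain q where q: "\<And>y. y \<in> cell x j \<Longrightarrow> v y = poly q y"
    using pw_polyE[OF assms] by blast
  have "set_integrable lborel {x (j-1)..x j} (poly q)"
    by (intro borel_integrable_atLeastAtMost' continuous_intros)
  then have "set_integrable lborel (cell x j) (poly q)"
    by (rule set_integrable_subset) (auto simp: cell_def)
  then show ?thesis
    using q by (subst set_integrable_cong[of lborel lborel _ "cell x j" _ "poly q"]) auto
qed

lemma cell_integral_cong:
  assumes "\<And>y. y \<in> cell x j \<Longrightarrow> v y = w y"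
  shows "(LBINT y:cell x j. v y) = (LBINT y:cell x j. w y)"
  using assms by (intro set_lebesgue_integral_cong) auto

lemma set_integral_mesh:
  assumes "pw_poly v"
  shows "(LBINT y:{x 0<..<x N}. v y) = (\<Sum>j=1..N. LBINT y:cell x j. v y)"
proof -
  have "(LBINT y:{x 0<..<x N}. v y) = (LBINT y:(\<Union>j\<in>{1..N}. cell x j). v y)"
  proof (rule set_integral_discrete_difference[of "x ` {0..N}"])
    have "y \<in> x ` {0..N} \<or> (\<exists>j\<in>{1..N}. y \<in> cell x j)" if y: "x 0 < y" "y < x N" for y
    proof -
      \<comment> \<open>The first node not to the left of \<open>y\<close>: then \<open>y\<close>
        lies in cell \<open>j\<close> or is the node \<open>x j\<close> itself.\<close>
      define j where "j = (LEAST j. y \<le> x j)"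
      have j: "y \<le> x j" "j \<le> N"
        unfolding j_def using y by (auto intro: LeastI[of _ N] Least_le)
      with y have "j \<noteq> 0"
        by (metis not_less)
      then have "x (j - 1) < y"
        using not_less_Least[of "j - 1" "\<lambda>j. y \<le> x j"] by (force simp: j_def)
      with j \<open>j \<noteq> 0\<close> show ?thesis
        by (cases "y = x j") (auto simp: cell_def)
    qed
    moreover have "cell x j \<subseteq> {x 0<..<x N}" if "j \<in> {1..N}" for j
      using that x_le[of 0 "j - 1"] x_le[of j N] by (force simp: cell_def)
    ultimately show "({x 0<..<x N} - (\<Union>j\<in>{1..N}. cell x j)) \<union>
        ((\<Union>j\<in>{1..N}. cell x j) - {x 0<..<x N}) \<subseteq> x ` {0..N}"
      by fastforce
  qed auto
  also have "\<dots> = (\<Sum>j=1..N. LBINT y:cell x j. v y)"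
  proof (rule set_integral_finite_Union)
    have "cell x i \<inter> cell x j = {}" if "i < j" "j \<le> N" for i j
      using x_le[of i "j - 1"] that by (force simp: cell_def)
    then show "disjoint_family_on (cell x) {1..N}"
      unfolding disjoint_family_on_def
      by (metis Int_commute atLeastAtMost_iff linorder_neqE_nat)
  qed (use assms in \<open>auto intro: set_integrable_cell\<close>)
  finally show ?thesis .
qed

section \<open>One-sided limits at the interfaces and periodicity\<close>

lemma tendsto_cell_ends:
  assumes "pw_poly v" "j \<in> {1..N}"
  shows "(v \<longlongrightarrow> tr_minus N x v j) (at_left (x j))"
    and "(v \<longlongrightarrow> tr_plus N x v (j - 1)) (at_right (x (j - 1)))"
    and "(LBINT y:cell x j. deriv v y) = tr_minus N x v j - tr_plus N x v (j - 1)"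
proof -
  obtain q where q: "\<And>y. y \<in> cell x j \<Longrightarrow> v y = poly q y"
    using pw_polyE[OF assms] by blast
  note lt = cell_nonempty[OF assms(2)]
  have "(poly q \<longlongrightarrow> poly q (x j)) (at_left (x j))"
    by (intro tendsto_intros)
  moreover have "\<forall>\<^sub>F y in at_left (x j). poly q y = v y"
    using eventually_at_left_real[OF lt] by eventually_elim (simp add: q cell_def)
  ultimately have l: "(v \<longlongrightarrow> poly q (x j)) (at_left (x j))"
    by (rule Lim_transform_eventually)
  have "(poly q \<longlongrightarrow> poly q (x (j-1))) (at_right (x (j-1)))"
    by (intro tendsto_intros)
  moreover have "\<forall>\<^sub>F y in at_right (x (j-1)). poly q y = v y"
    using eventually_at_right_real[OF lt] by eventually_elim (simp add: q cell_def)
  ultimately have r: "(v \<longlongrightarrow> poly q (x (j-1))) (at_right (x (j-1)))"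
    by (rule Lim_transform_eventually)
  have l': "tr_minus N x v j = poly q (x j)"
    using tendsto_Lim[OF _ l] assms(2) by (auto simp: tr_minus_def)
  have r': "tr_plus N x v (j-1) = poly q (x (j-1))"
    using tendsto_Lim[OF _ r] assms(2) by (auto simp: tr_plus_def)
  show "(v \<longlongrightarrow> tr_minus N x v j) (at_left (x j))"
    using l l' by simp
  show "(v \<longlongrightarrow> tr_plus N x v (j - 1)) (at_right (x (j - 1)))"
    using r r' by simp
  \<comment> \<open>\<open>v\<close> is controlled only on the open cell, so the integral is moved
    to \<open>q\<close> and then to the closed cell, where the fundamental theorem applies; the end
    values of \<open>q\<close> are the traces of \<open>v\<close>.\<close>
  have "(LBINT y:cell x j. deriv v y) = (LBINT y:cell x j. poly (pderiv q) y)"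
    by (intro cell_integral_cong) (metis DERIV_cell DERIV_imp_deriv q)
  also have "\<dots> = (LBINT y:{x (j-1)..x j}. poly (pderiv q) y)"
    by (rule set_integral_discrete_difference[of "{x (j-1), x j}"]) (auto simp: cell_def)
  also have "\<dots> = (\<integral>y. poly (pderiv q) y * indicator {x (j-1)..x j} y \<partial>lborel)"
    by (simp add: set_lebesgue_integral_def mult.commute)
  also have "\<dots> = poly q (x j) - poly q (x (j-1))"
    using lt by (intro integral_FTC_Icc_real) auto
  finally show "(LBINT y:cell x j. deriv v y) = tr_minus N x v j - tr_plus N x v (j - 1)"
    by (simp only: l' r')
qed

lemma tr_minus_eqI:
  assumes "j \<in> {1..N}" "(v \<longlongrightarrow> a) (at_left (x j))"
  shows "tr_minus N x v j = a"
  using tendsto_Lim[OF _ assms(2)] assms(1) by (auto simp: tr_minus_def)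

lemma tr_plus_periodic: "tr_plus N x v 0 = tr_plus N x v N"
  using N_pos by (simp add: tr_plus_def)

lemma tr_minus_periodic: "tr_minus N x v 0 = tr_minus N x v N"
  using N_pos by (simp add: tr_minus_def)

lemma tendsto_tr_plus:
  assumes "pw_poly v" "j \<in> {1..N}"
  shows "(v \<longlongrightarrow> tr_plus N x v j) (at_right (x (if j = N then 0 else j)))"
  \<comment> \<open>The right limit at interface \<open>j\<close> belongs to cell
    \<open>j + 1\<close>, and by periodicity to cell 1 when \<open>j = N\<close>.\<close>
  using tendsto_cell_ends(2)[OF assms(1), of "if j = N then 1 else j + 1"] assms(2)
  by (auto simp: tr_plus_periodic split: if_splits)

lemma tr_plus_eqI:
  assumes "(v \<longlongrightarrow> a) (at_right (x (if j = N then 0 else j)))"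
  shows "tr_plus N x v j = a"
  using tendsto_Lim[OF _ assms] by (auto simp: tr_plus_def)

lemma sum_shift_periodic:
  fixes a :: "nat \<Rightarrow> real"
  assumes "a 0 = a N"
  shows "(\<Sum>j=1..N. a (j - 1)) = (\<Sum>j=1..N. a j)"
proof -
  \<comment> \<open>Keeping the two end terms makes the identity true for every \<open>n\<close>,
    hence provable by induction; periodicity cancels them at \<open>N\<close>.\<close>
  have "(\<Sum>j=1..n. a (j - 1)) + a n = (\<Sum>j=1..n. a j) + a 0" for n
    by (induction n) auto
  from this[of N] assms show ?thesis
    by simp
qed

lemma sum_cell_integral_deriv:
  assumes "pw_poly v"
  shows "(\<Sum>j=1..N. LBINT y:cell x j. deriv v y) = (\<Sum>j=1..N. tr_minus N x v j - tr_plus N x v j)"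
  using sum_shift_periodic[of "tr_plus N x v", OF tr_plus_periodic] tendsto_cell_ends(3)[OF assms]
  by (simp add: sum_subtractf)

lemma tr_const [simp]:
  "j \<in> {1..N} \<Longrightarrow> tr_minus N x (\<lambda>y. c) j = c" "tr_plus N x (\<lambda>y. c) j = c"
  by (auto intro!: tr_minus_eqI tr_plus_eqI)

lemma tr_isCont:
  assumes "pw_poly v" "j \<in> {1..N}" "\<And>z. isCont \<phi> z"
  shows "tr_minus N x (\<lambda>y. \<phi> (v y)) j = \<phi> (tr_minus N x v j)"
    and "tr_plus N x (\<lambda>y. \<phi> (v y)) j = \<phi> (tr_plus N x v j)"
  by (auto intro!: tr_minus_eqI tr_plus_eqI isCont_tendsto_compose[OF assms(3)]
      tendsto_cell_ends(1) tendsto_tr_plus assms simp del: One_nat_def)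

lemma tr_mult:
  assumes "pw_poly v" "pw_poly w" "j \<in> {1..N}"
  shows "tr_minus N x (\<lambda>y. v y * w y) j = tr_minus N x v j * tr_minus N x w j"
    and "tr_plus N x (\<lambda>y. v y * w y) j = tr_plus N x v j * tr_plus N x w j"
  by (intro tr_minus_eqI tr_plus_eqI tendsto_mult tendsto_cell_ends(1) tendsto_tr_plus assms)+

section \<open>The inner product summed over the cells\<close>

definition mesh_inner :: "(real \<Rightarrow> real) \<Rightarrow> (real \<Rightarrow> real) \<Rightarrow> real" where
  "mesh_inner w v = (\<Sum>j=1..N. cell_inner x j w v)"

lemma cell_inner_commute: "cell_inner x j w v = cell_inner x j v w"
  by (simp add: cell_inner_def mult.commute)

lemma mesh_inner_commute: "mesh_inner w v = mesh_inner v w"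
  by (simp add: mesh_inner_def cell_inner_commute)

lemma cell_inner_diff_left:
  assumes "pw_poly w1" "pw_poly w2" "pw_poly v" "j \<in> {1..N}"
  shows "cell_inner x j (\<lambda>y. w1 y - w2 y) v = cell_inner x j w1 v - cell_inner x j w2 v"
  using assms by (auto simp: cell_inner_def left_diff_distrib set_integrable_cell)

lemma cell_inner_lincomb_left:
  assumes "finite S" "\<And>i. i \<in> S \<Longrightarrow> pw_poly (L i)" "pw_poly v" "j \<in> {1..N}"
  shows "cell_inner x j (\<lambda>y. \<Sum>i\<in>S. c i * L i y) v = (\<Sum>i\<in>S. c i * cell_inner x j (L i) v)"
proof -
  have "cell_inner x j (\<lambda>y. \<Sum>i\<in>S. c i * L i y) v
      = (LBINT y:cell x j. (\<Sum>i\<in>S. c i * (L i y * v y)))"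
    by (simp add: cell_inner_def sum_distrib_right mult.assoc)
  also have "\<dots> = (\<Sum>i\<in>S. LBINT y:cell x j. c i * (L i y * v y))"
    using assms unfolding set_lebesgue_integral_def scaleR_sum_right
    by (intro Bochner_Integration.integral_sum set_integrable_cell[unfolded set_integrable_def]) auto
  finally show ?thesis
    by (simp add: cell_inner_def)
qed

lemma cell_inner_cong:
  assumes "\<And>y. y \<in> cell x j \<Longrightarrow> w y = w' y" "\<And>y. y \<in> cell x j \<Longrightarrow> v y = v' y"
  shows "cell_inner x j w v = cell_inner x j w' v'"
  unfolding cell_inner_def using assms by (intro cell_integral_cong) auto

lemma mesh_inner_diff_left:
  assumes "pw_poly w1" "pw_poly w2" "pw_poly v"
  shows "mesh_inner (\<lambda>y. w1 y - w2 y) v = mesh_inner w1 v - mesh_inner w2 v"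
  using assms by (simp add: mesh_inner_def cell_inner_diff_left sum_subtractf)

lemma mesh_inner_diff_right:
  assumes "pw_poly w1" "pw_poly w2" "pw_poly v"
  shows "mesh_inner v (\<lambda>y. w1 y - w2 y) = mesh_inner v w1 - mesh_inner v w2"
  using mesh_inner_diff_left[OF assms] by (simp add: mesh_inner_commute)

lemma mesh_inner_self_nonneg: "0 \<le> mesh_inner v v"
  unfolding mesh_inner_def cell_inner_def set_lebesgue_integral_def
  by (intro sum_nonneg integral_nonneg) (auto simp: indicator_def)

lemma l2_norm_mesh:
  assumes "pw_poly v"
  shows "(l2_norm {x 0<..<x N} v)\<^sup>2 = mesh_inner v v"
proof -
  have "(LBINT y:{x 0<..<x N}. (v y)\<^sup>2) = mesh_inner v v"
    using assms by (simp add: set_integral_mesh mesh_inner_def cell_inner_def power2_eq_square)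
  then show ?thesis
    using mesh_inner_self_nonneg[of v] by (simp add: l2_norm_def)
qed

section \<open>Weak derivatives summed over the mesh, and their exact cancellations\<close>

definition mesh_form :: "(real \<Rightarrow> real) \<Rightarrow> (nat \<Rightarrow> real) \<Rightarrow> (real \<Rightarrow> real) \<Rightarrow> real" where
  "mesh_form F Fh v = (\<Sum>j=1..N. dg_form N x j F Fh v)"

text \<open>Shifting the left-end terms by one index collects both contributions of an interface
  there, so that the flux multiplies the jump of \<open>v\<close> (left minus right limit).\<close>

lemma mesh_form_eq:
  assumes "Fh 0 = Fh N"
  shows "mesh_form F Fh v =
    (\<Sum>j=1..N. Fh j * (tr_minus N x v j - tr_plus N x v j)) - mesh_inner F (deriv v)"
proof -
  have "(\<Sum>j=1..N. Fh (j - 1) * tr_plus N x v (j - 1)) = (\<Sum>j=1..N. Fh j * tr_plus N x v j)"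
    using sum_shift_periodic[of "\<lambda>j. Fh j * tr_plus N x v j"] assms by (simp add: tr_plus_periodic)
  then show ?thesis
    by (simp add: mesh_form_def dg_form_def mesh_inner_def sum.distrib sum_subtractf
        sum_negf right_diff_distrib)
qed

lemma mesh_form_const: "Fh 0 = Fh N \<Longrightarrow> mesh_form F Fh (\<lambda>y. c) = 0"
  by (simp add: mesh_form_eq mesh_inner_def cell_inner_def)

text \<open>When the combined integrand is an exact derivative \<open>W'\<close>, the volume terms
  integrate to jumps of \<open>W\<close> and only a sum over interfaces remains. Two forms are
  treated together because in the adjoint and product identities neither integrand is exact by
  itself.\<close>

lemma sum_mesh_form_primitive:
  assumes "Fh 0 = Fh N" "Gh 0 = Gh N" "pw_poly F" "pw_poly G" "pw_poly v" "pw_poly w" "pw_poly W"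
    and W: "\<And>j y. j \<in> {1..N} \<Longrightarrow> y \<in> cell x j \<Longrightarrow>
      (W has_real_derivative F y * deriv v y + G y * deriv w y) (at y)"
  shows "mesh_form F Fh v + mesh_form G Gh w =
    (\<Sum>j=1..N. Fh j * (tr_minus N x v j - tr_plus N x v j)
      + Gh j * (tr_minus N x w j - tr_plus N x w j) - (tr_minus N x W j - tr_plus N x W j))"
proof -
  have "mesh_inner F (deriv v) + mesh_inner G (deriv w) = (\<Sum>j=1..N. LBINT y:cell x j. deriv W y)"
    unfolding mesh_inner_def sum.distrib[symmetric]
  proof (rule sum.cong[OF refl])
    fix j assume j: "j \<in> {1..N}"
    have "cell_inner x j F (deriv v) + cell_inner x j G (deriv w)
        = (LBINT y:cell x j. F y * deriv v y + G y * deriv w y)"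
      unfolding cell_inner_def using assms j
      by (subst set_integral_add(2)) (auto intro: set_integrable_cell)
    also have "\<dots> = (LBINT y:cell x j. deriv W y)"
      by (intro cell_integral_cong) (metis DERIV_imp_deriv W j)
    finally show "cell_inner x j F (deriv v) + cell_inner x j G (deriv w) = \<dots>" .
  qed
  then show ?thesis
    using assms(1,2) sum_cell_integral_deriv[OF \<open>pw_poly W\<close>]
    by (simp add: mesh_form_eq sum.distrib sum_subtractf)
qed

lemma mesh_form_primitive:
  assumes "Fh 0 = Fh N" "pw_poly F" "pw_poly v" "pw_poly W"
    and "\<And>j y. j \<in> {1..N} \<Longrightarrow> y \<in> cell x j \<Longrightarrow> (W has_real_derivative F y * deriv v y) (at y)"
  shows "mesh_form F Fh v = (\<Sum>j=1..N. Fh j * (tr_minus N x v j - tr_plus N x v j)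
      - (tr_minus N x W j - tr_plus N x W j))"
  using sum_mesh_form_primitive[where G="\<lambda>_. 0" and Gh="\<lambda>_. 0" and w="\<lambda>_. 0", of Fh F v W] assms
  by (simp add: mesh_form_const)

text \<open>Here \<open>W = v * w\<close>. With opposite-sided fluxes the interface terms cancel:
  the jump of \<open>v * w\<close> is \<open>w^-\<close> times the jump of \<open>v\<close> plus
  \<open>v^+\<close> times the jump of \<open>w\<close>.\<close>

lemma mesh_form_adjoint:
  assumes "pw_poly v" "pw_poly w"
  shows "mesh_form w (tr_minus N x w) v + mesh_form v (tr_plus N x v) w = 0"
proof -
  have "mesh_form w (tr_minus N x w) v + mesh_form v (tr_plus N x v) w =
    (\<Sum>j=1..N. tr_minus N x w j * (tr_minus N x v j - tr_plus N x v j)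
      + tr_plus N x v j * (tr_minus N x w j - tr_plus N x w j)
      - (tr_minus N x (\<lambda>y. v y * w y) j - tr_plus N x (\<lambda>y. v y * w y) j))"
    using assms by (intro sum_mesh_form_primitive)
      (auto intro!: derivative_eq_intros pw_poly_DERIV simp: tr_minus_periodic tr_plus_periodic)
  also have "\<dots> = 0"
    using assms by (intro sum.neutral) (simp add: tr_mult algebra_simps)
  finally show ?thesis .
qed

text \<open>Here \<open>W = (u * r)^2 / 2\<close>. The factors \<open>r^+\<close> and
  \<open>u^-\<close> combine the jumps of \<open>u\<close> and \<open>r\<close> into the jump of
  \<open>u * r\<close>, and the average of \<open>u * r\<close> times that jump is exactly the jump
  of \<open>W\<close>.\<close>

lemma mesh_form_product:
  assumes u: "pw_poly u" and r: "pw_poly r"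
  defines "ur \<equiv> avg N x (\<lambda>y. u y * r y)"
  shows "mesh_form (\<lambda>y. (r y)\<^sup>2 * u y) (\<lambda>i. ur i * tr_plus N x r i) u
    + mesh_form (\<lambda>y. (u y)\<^sup>2 * r y) (\<lambda>i. ur i * tr_minus N x u i) r = 0" (is "?lhs = 0")
proof -
  have "?lhs = (\<Sum>j=1..N. ur j * tr_plus N x r j * (tr_minus N x u j - tr_plus N x u j)
      + ur j * tr_minus N x u j * (tr_minus N x r j - tr_plus N x r j)
      - (tr_minus N x (\<lambda>y. (u y * r y)\<^sup>2 / 2) j - tr_plus N x (\<lambda>y. (u y * r y)\<^sup>2 / 2) j))"
    using u r by (intro sum_mesh_form_primitive)
      (auto intro!: derivative_eq_intros pw_poly_DERIV
        simp: ur_def avg_def tr_minus_periodic tr_plus_periodic power2_eq_square field_simps)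
  also have "\<dots> = 0"
  proof (intro sum.neutral ballI)
    fix j assume j: "j \<in> {1..N}"
    have "tr_minus N x (\<lambda>y. (u y * r y)\<^sup>2 / 2) j = (tr_minus N x u j * tr_minus N x r j)\<^sup>2 / 2"
      "tr_plus N x (\<lambda>y. (u y * r y)\<^sup>2 / 2) j = (tr_plus N x u j * tr_plus N x r j)\<^sup>2 / 2"
      using u r j tr_isCont[of "\<lambda>y. u y * r y" j "\<lambda>z. z\<^sup>2 / 2"] by (auto simp: tr_mult)
    then show "ur j * tr_plus N x r j * (tr_minus N x u j - tr_plus N x u j)
      + ur j * tr_minus N x u j * (tr_minus N x r j - tr_plus N x r j)
      - (tr_minus N x (\<lambda>y. (u y * r y)\<^sup>2 / 2) j - tr_plus N x (\<lambda>y. (u y * r y)\<^sup>2 / 2) j) = 0"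
      using u r j by (simp add: ur_def avg_def tr_mult field_simps power2_eq_square)
  qed
  finally show ?thesis .
qed

end

section \<open>Entropy production of the numerical fluxes at an interface\<close>

lemma quartic_convexity:
  fixes a b :: real
  shows "0 \<le> 4 * a ^ 3 * (a - b) - (a ^ 4 - b ^ 4)"
proof -
  \<comment> \<open>The tangent of the convex function \<open>z^4\<close> at \<open>a\<close> lies
    below its graph. The cofactor \<open>3 a^2 + 2 a b + b^2\<close> is written as a sum of
    squares.\<close>
  have "4 * a ^ 3 * (a - b) - (a ^ 4 - b ^ 4) = (a - b)\<^sup>2 * (2 * a\<^sup>2 + (a + b)\<^sup>2)"
    by algebra
  then show ?thesis
    by simp
qed

text \<open>The conservative flux is the difference quotient of the primitive
  \<open>\<kappa>^2 z^2 + z^4 / 4\<close> of \<open>mch_f\<close>, so it produces no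
  entropy.\<close>

lemma f_flux_Conservative:
  "f_flux Conservative \<kappa> a b * (a - b) = (\<kappa>\<^sup>2 * a\<^sup>2 + a ^ 4 / 4) - (\<kappa>\<^sup>2 * b\<^sup>2 + b ^ 4 / 4)"
  by (simp add: power2_eq_square power4_eq_xxxx algebra_simps diff_divide_distrib add_divide_distrib)

text \<open>In the dissipative case the flux is the slope of this convex primitive at the left value
  \<open>a\<close>, so the tangent inequality at \<open>a\<close> applies.\<close>

lemma f_flux_entropy:
  "(\<kappa>\<^sup>2 * a\<^sup>2 + a ^ 4 / 4) - (\<kappa>\<^sup>2 * b\<^sup>2 + b ^ 4 / 4) \<le> f_flux sch \<kappa> a b * (a - b)"
proof (cases sch)
  case Dissipative
  have "mch_f \<kappa> a * (a - b) - ((\<kappa>\<^sup>2 * a\<^sup>2 + a ^ 4 / 4) - (\<kappa>\<^sup>2 * b\<^sup>2 + b ^ 4 / 4))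
      = (\<kappa> * (a - b))\<^sup>2 + (4 * a ^ 3 * (a - b) - (a ^ 4 - b ^ 4)) / 4"
    unfolding mch_f_def
    by (simp add: power2_eq_square power3_eq_cube power4_eq_xxxx algebra_simps
        diff_divide_distrib add_divide_distrib)
  also have "\<dots> \<ge> 0"
    by (intro add_nonneg_nonneg divide_nonneg_nonneg quartic_convexity) simp_all
  finally show ?thesis
    unfolding Dissipative f_flux.simps by (simp only: diff_ge_0_iff_ge)
next
  case Conservative
  show ?thesis
    unfolding Conservative f_flux_Conservative by (rule order_refl)
qed

lemma g_flux_Conservative: "g_flux Conservative a b * (a - b) = a ^ 4 / 12 - b ^ 4 / 12"
  by (simp add: power2_eq_square power4_eq_xxxx algebra_simps diff_divide_distrib add_divide_distrib)

text \<open>The inequality is reversed because the slope is now taken at the right value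
  \<open>b\<close>. This is the sign required later, as the \<open>g\<close> contribution enters the
  energy balance opposite to the \<open>f\<close> contribution.\<close>

lemma g_flux_entropy: "g_flux sch a b * (a - b) \<le> a ^ 4 / 12 - b ^ 4 / 12"
proof (cases sch)
  case Dissipative
  have "(a ^ 4 / 12 - b ^ 4 / 12) - mch_g b * (a - b)
      = (4 * b ^ 3 * (b - a) - (b ^ 4 - a ^ 4)) / 12"
    by (simp add: mch_g_def power3_eq_cube power4_eq_xxxx algebra_simps
        diff_divide_distrib add_divide_distrib)
  also have "\<dots> \<ge> 0"
    by (intro divide_nonneg_nonneg quartic_convexity) simp
  finally show ?thesis
    unfolding Dissipative g_flux.simps by (simp only: diff_ge_0_iff_ge)
next
  case Conservative
  show ?thesis
    unfolding Conservative g_flux_Conservative by (rule order_refl)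
qed

section \<open>The summed scheme and its test functions\<close>

context dg_mesh
begin

lemma sum_dg_equations:
  assumes "ldg_equations sch \<kappa> k N x mt u p r m s"
  defines "ur \<equiv> avg N x (\<lambda>y. u y * r y)"
  shows "v \<in> dg_space k N x \<Longrightarrow> mesh_inner mt v
      + mesh_form (\<lambda>y. mch_f \<kappa> (u y)) (\<lambda>i. f_flux sch \<kappa> (tr_minus N x u i) (tr_plus N x u i)) v
      - mesh_form p (tr_plus N x p) v
      + mesh_form (\<lambda>y. (r y)\<^sup>2 * u y) (\<lambda>i. ur i * tr_plus N x r i) v
      + mesh_form s (tr_plus N x s) v = 0"
    and "v \<in> dg_space k N x \<Longrightarrow>
      mesh_inner p v = mesh_form (\<lambda>y. (u y)\<^sup>2 * r y) (\<lambda>i. ur i * tr_minus N x u i) v"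
    and "v \<in> dg_space k N x \<Longrightarrow> mesh_inner r v = mesh_form u (tr_minus N x u) v"
    and "v \<in> dg_space k N x \<Longrightarrow>
      mesh_inner m v = mesh_inner u v - mesh_form r (tr_plus N x r) v"
    and "v \<in> dg_space k N x \<Longrightarrow> mesh_inner s v =
      mesh_form (\<lambda>y. mch_g (r y)) (\<lambda>i. g_flux sch (tr_minus N x r i) (tr_plus N x r i)) v"
proof -
  let ?f = "\<lambda>i. f_flux sch \<kappa> (tr_minus N x u i) (tr_plus N x u i)"
  let ?g = "\<lambda>i. g_flux sch (tr_minus N x r i) (tr_plus N x r i)"
  have eqs: "cell_inner x j mt v + dg_form N x j (\<lambda>y. mch_f \<kappa> (u y)) ?f v
      - dg_form N x j p (tr_plus N x p) v
      + dg_form N x j (\<lambda>y. (r y)\<^sup>2 * u y) (\<lambda>i. ur i * tr_plus N x r i) v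
      + dg_form N x j s (tr_plus N x s) v = 0"
    "cell_inner x j p v = dg_form N x j (\<lambda>y. (u y)\<^sup>2 * r y) (\<lambda>i. ur i * tr_minus N x u i) v"
    "cell_inner x j r v = dg_form N x j u (tr_minus N x u) v"
    "cell_inner x j m v = cell_inner x j u v - dg_form N x j r (tr_plus N x r) v"
    "cell_inner x j s v = dg_form N x j (\<lambda>y. mch_g (r y)) ?g v"
    if "v \<in> dg_space k N x" "j \<in> {1..N}" for v j
    using bspec[OF assms(1)[unfolded ldg_equations_def Let_def] that(2)] that(1)
    by (simp_all add: ur_def) (smt (verit, best))
  note defs = mesh_inner_def mesh_form_def sum.distrib[symmetric] sum_subtractf[symmetric]
  assume v: "v \<in> dg_space k N x"
  show "mesh_inner mt v + mesh_form (\<lambda>y. mch_f \<kappa> (u y)) ?f v - mesh_form p (tr_plus N x p) v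
      + mesh_form (\<lambda>y. (r y)\<^sup>2 * u y) (\<lambda>i. ur i * tr_plus N x r i) v
      + mesh_form s (tr_plus N x s) v = 0"
    unfolding defs by (intro sum.neutral ballI eqs(1)[OF v])
  show "mesh_inner p v = mesh_form (\<lambda>y. (u y)\<^sup>2 * r y) (\<lambda>i. ur i * tr_minus N x u i) v"
    "mesh_inner r v = mesh_form u (tr_minus N x u) v"
    "mesh_inner m v = mesh_inner u v - mesh_form r (tr_plus N x r) v"
    "mesh_inner s v = mesh_form (\<lambda>y. mch_g (r y)) ?g v"
    unfolding defs by (intro sum.cong refl eqs(2-)[OF v]; assumption)+
qed

text \<open>Two sets of equations are allowed so that \<open>m\<close> at one time can be paired
  with \<open>u\<close> at another. The first \<open>m\<close> equation is tested with
  \<open>u'\<close>, the second \<open>r\<close> equation with \<open>r\<close>, and the forms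
  cancel by adjointness.\<close>

lemma mesh_inner_m:
  assumes "ldg_equations sch \<kappa> k N x mt u p r m s" "ldg_equations sch' \<kappa>' k N x mt' u' p' r' m' s'"
    and "{u, r, u', r'} \<subseteq> dg_space k N x"
  shows "mesh_inner m u' = mesh_inner u u' + mesh_inner r r'"
proof -
  have "mesh_inner m u' = mesh_inner u u' - mesh_form r (tr_plus N x r) u'"
    using sum_dg_equations(4)[OF assms(1)] assms(3) by simp
  moreover have "mesh_inner r' r = mesh_form u' (tr_minus N x u') r"
    using sum_dg_equations(3)[OF assms(2)] assms(3) by simp
  moreover have "mesh_form u' (tr_minus N x u') r + mesh_form r (tr_plus N x r) u' = 0"
    using assms(3) by (intro mesh_form_adjoint) (auto dest: dg_space_imp_pw_poly)
  ultimately show ?thesis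
    by (simp add: mesh_inner_commute)
qed

text \<open>A constant has no derivative and no jumps, so every form vanishes by periodicity of the
  fluxes.\<close>

lemma mesh_inner_mt_const:
  assumes "ldg_equations sch \<kappa> k N x mt u p r m s"
  shows "mesh_inner mt (\<lambda>y. 1) = 0"
proof -
  have "(\<lambda>y. 1) \<in> dg_space k N x"
    by (auto simp: dg_space_def intro!: exI[of _ 1])
  from sum_dg_equations(1)[OF assms this] show ?thesis
    by (simp add: mesh_form_const tr_plus_periodic tr_minus_periodic avg_def)
qed

lemma mesh_inner_mt_u:
  assumes "ldg_equations sch \<kappa> k N x mt u p r m s" and V: "{u, p, r, s} \<subseteq> dg_space k N x"
  shows "mesh_inner mt u \<le> 0"
    and "sch = Conservative \<Longrightarrow> mesh_inner mt u = 0"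
proof -
  note eqs = sum_dg_equations[OF assms(1)]
  have [simp]: "pw_poly u" "pw_poly p" "pw_poly r" "pw_poly s"
    using V by (auto dest: dg_space_imp_pw_poly)
  define Ff where "Ff = mesh_form (\<lambda>y. mch_f \<kappa> (u y))
    (\<lambda>i. f_flux sch \<kappa> (tr_minus N x u i) (tr_plus N x u i)) u"
  define Gg where "Gg = mesh_form (\<lambda>y. mch_g (r y))
    (\<lambda>i. g_flux sch (tr_minus N x r i) (tr_plus N x r i)) r"
  \<comment> \<open>Adjointness turns the form into one of \<open>u\<close> tested with
    \<open>p\<close>, which the equation for \<open>r\<close> evaluates; likewise for
    \<open>s\<close>.\<close>
  have p: "mesh_form p (tr_plus N x p) u = - mesh_inner p r"
    using mesh_form_adjoint[of p u] eqs(3)[of p] V by (simp add: mesh_inner_commute)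
  have s: "mesh_form s (tr_plus N x s) u = - mesh_inner s r"
    using mesh_form_adjoint[of s u] eqs(3)[of s] V by (simp add: mesh_inner_commute)
  \<comment> \<open>The term \<open>mesh_inner p r\<close> equals the form of \<open>u^2 r\<close>
    tested with \<open>r\<close> and cancels against that of \<open>r^2 u\<close> tested with
    \<open>u\<close>, while \<open>mesh_inner s r\<close> equals \<open>Gg\<close>.\<close>
  have main: "mesh_inner mt u = Gg - Ff"
    using eqs(1)[of u] eqs(2)[of r] eqs(5)[of r] p s mesh_form_product[of u r] V
    by (simp add: Ff_def Gg_def)
  \<comment> \<open>Primitives of \<open>mch_f \<kappa>\<close> and \<open>mch_g\<close>.\<close>
  let ?W = "\<lambda>z. \<kappa>\<^sup>2 * z\<^sup>2 + z ^ 4 / 4"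
  let ?Z = "\<lambda>z. z ^ 4 / 12 :: real"
  have "Ff = (\<Sum>j=1..N. f_flux sch \<kappa> (tr_minus N x u j) (tr_plus N x u j)
        * (tr_minus N x u j - tr_plus N x u j)
      - (tr_minus N x (\<lambda>y. ?W (u y)) j - tr_plus N x (\<lambda>y. ?W (u y)) j))"
    unfolding Ff_def
    by (intro mesh_form_primitive)
      (auto intro!: derivative_eq_intros pw_poly_DERIV
        simp: mch_f_def tr_minus_periodic tr_plus_periodic algebra_simps)
  also have "\<dots> = (\<Sum>j=1..N. f_flux sch \<kappa> (tr_minus N x u j) (tr_plus N x u j)
        * (tr_minus N x u j - tr_plus N x u j) - (?W (tr_minus N x u j) - ?W (tr_plus N x u j)))"
    by (intro sum.cong refl) (simp add: tr_isCont[where \<phi>="?W"])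
  finally have Ff: "Ff = \<dots>" .
  have "Gg = (\<Sum>j=1..N. g_flux sch (tr_minus N x r j) (tr_plus N x r j)
        * (tr_minus N x r j - tr_plus N x r j)
      - (tr_minus N x (\<lambda>y. ?Z (r y)) j - tr_plus N x (\<lambda>y. ?Z (r y)) j))"
    unfolding Gg_def
    by (intro mesh_form_primitive)
      (auto intro!: derivative_eq_intros pw_poly_DERIV
        simp: mch_g_def tr_minus_periodic tr_plus_periodic)
  also have "\<dots> = (\<Sum>j=1..N. g_flux sch (tr_minus N x r j) (tr_plus N x r j)
        * (tr_minus N x r j - tr_plus N x r j) - (?Z (tr_minus N x r j) - ?Z (tr_plus N x r j)))"
    by (intro sum.cong refl) (simp add: tr_isCont[where \<phi>="?Z"])
  finally have Gg: "Gg = \<dots>" .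
  have "0 \<le> Ff" "Gg \<le> 0"
    unfolding Ff Gg
    by (intro sum_nonneg sum_nonpos, simp_all only: diff_ge_0_iff_ge diff_le_0_iff_le
        f_flux_entropy g_flux_entropy)+
  then show "mesh_inner mt u \<le> 0"
    using main by simp
  assume c: "sch = Conservative"
  have "Ff = 0" "Gg = 0"
    unfolding Ff Gg c f_flux_Conservative g_flux_Conservative by simp_all
  then show "mesh_inner mt u = 0"
    using main by simp
qed

section \<open>Differentiation in time\<close>

lemma dg_space_lagrange:
  assumes "j \<in> {1..N}"
  obtains S and L :: "real \<Rightarrow> real poly" where "finite S" "S \<subseteq> cell x j"
    and "\<And>v y. v \<in> dg_space k N x \<Longrightarrow> y \<in> cell x j \<Longrightarrow> v y = (\<Sum>i\<in>S. v i * poly (L i) y)"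
proof -
  have "infinite (cell x j)"
    using cell_nonempty[OF assms] by (simp add: cell_def infinite_Ioo)
  \<comment> \<open>The \<open>k + 1\<close> nodes and their basis depend only on the cell, so the
    same expansion serves all times.\<close>
  then obtain S where S: "finite S" "card S = Suc k" "S \<subseteq> cell x j"
    using infinite_arbitrarily_large by blast
  obtain L :: "real \<Rightarrow> real poly"
    where L: "\<And>q. degree q \<le> k \<Longrightarrow> q = (\<Sum>i\<in>S. smult (poly q i) (L i))"
    using poly_lagrange_basis[OF S(1,2)] by blast
  show thesis
  proof
    fix v y assume "v \<in> dg_space k N x" and y: "y \<in> cell x j"
    then obtain q where q: "degree q \<le> k" "\<And>y. y \<in> cell x j \<Longrightarrow> v y = poly q y"
      using assms unfolding dg_space_def by blast
    have "v y = poly (\<Sum>i\<in>S. smult (poly q i) (L i)) y"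
      using q y L[OF q(1)] by simp
    also have "\<dots> = (\<Sum>i\<in>S. v i * poly (L i) y)"
      using S(3) q(2) by (auto simp: poly_sum intro!: sum.cong)
    finally show "v y = (\<Sum>i\<in>S. v i * poly (L i) y)" .
  qed (use S in auto)
qed

lemma cell_inner_time_derivative:
  fixes m :: "real \<Rightarrow> real \<Rightarrow> real"
  assumes j: "j \<in> {1..N}" and t: "t \<in> J" "at t within J \<noteq> bot"
    and mV: "\<And>\<tau>. \<tau> \<in> J \<Longrightarrow> m \<tau> \<in> dg_space k N x"
    and diff: "\<And>y. y \<in> cell x j \<Longrightarrow> (\<lambda>\<tau>. m \<tau> y) differentiable (at t within J)"
  shows "pw_poly v \<Longrightarrow> ((\<lambda>\<tau>. cell_inner x j (m \<tau>) v) has_real_derivative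
      cell_inner x j (\<lambda>y. vector_derivative (\<lambda>\<tau>. m \<tau> y) (at t within J)) v) (at t within J)"
    and "((\<lambda>\<tau>. cell_inner x j (\<lambda>y. m \<tau> y - m t y) (\<lambda>y. m \<tau> y - m t y))
      has_real_derivative 0) (at t within J)"
proof -
  obtain S and L :: "real \<Rightarrow> real poly" where S: "finite S" "S \<subseteq> cell x j"
    and L: "\<And>v y. v \<in> dg_space k N x \<Longrightarrow> y \<in> cell x j \<Longrightarrow> v y = (\<Sum>i\<in>S. v i * poly (L i) y)"
    by (rule dg_space_lagrange[OF j, where k=k]) (rule that)
  \<comment> \<open>Interpolation at points of the cell turns pointwise differentiability of \<open>m\<close> into
    differentiability of finitely many coefficients.\<close>
  define mt where "mt y = vector_derivative (\<lambda>\<tau>. m \<tau> y) (at t within J)" for y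
  have mt: "((\<lambda>\<tau>. m \<tau> y) has_real_derivative mt y) (at t within J)" if "y \<in> cell x j" for y
    using diff[OF that] unfolding mt_def has_real_derivative_iff_has_vector_derivative
    by (simp add: vector_derivative_works)
  \<comment> \<open>Differentiating the expansion of \<open>m\<close> shows that the pointwise time
    derivative obeys the same interpolation formula; uniqueness of the derivative uses that
    \<open>t\<close> is not isolated in \<open>J\<close>.\<close>
  have mt_L: "mt y = (\<Sum>i\<in>S. mt i * poly (L i) y)" if y: "y \<in> cell x j" for y
  proof -
    have "((\<lambda>\<tau>. \<Sum>i\<in>S. m \<tau> i * poly (L i) y) has_real_derivative (\<Sum>i\<in>S. mt i * poly (L i) y))
        (at t within J)"
      using S(2) by (auto intro!: derivative_eq_intros mt)
    then have "((\<lambda>\<tau>. m \<tau> y) has_real_derivative (\<Sum>i\<in>S. mt i * poly (L i) y)) (at t within J)"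
      by (rule has_field_derivative_transform_within[where d=1]) (simp_all add: t L[OF mV y])
    then show ?thesis
      unfolding mt_def
      by (intro vector_derivative_within t(2)) (simp add: has_real_derivative_iff_has_vector_derivative)
  qed
  show "((\<lambda>\<tau>. cell_inner x j (m \<tau>) v) has_real_derivative
      cell_inner x j (\<lambda>y. vector_derivative (\<lambda>\<tau>. m \<tau> y) (at t within J)) v) (at t within J)"
    if v: "pw_poly v"
  proof -
    have ci: "cell_inner x j w v = (\<Sum>i\<in>S. w i * cell_inner x j (poly (L i)) v)"
      if "\<And>y. y \<in> cell x j \<Longrightarrow> w y = (\<Sum>i\<in>S. w i * poly (L i) y)" for w
      using cell_inner_cong[of j w "\<lambda>y. \<Sum>i\<in>S. w i * poly (L i) y" v v, OF that refl]
        cell_inner_lincomb_left[of S "\<lambda>i. poly (L i)" v j w, OF S(1) pw_poly_poly v j]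
      by (rule trans)
    have ci_m: "cell_inner x j (m \<tau>) v = (\<Sum>i\<in>S. m \<tau> i * cell_inner x j (poly (L i)) v)"
      if "\<tau> \<in> J" for \<tau>
      using that by (intro ci L mV)
    have "cell_inner x j mt v = (\<Sum>i\<in>S. mt i * cell_inner x j (poly (L i)) v)"
      by (intro ci mt_L)
    then have "((\<lambda>\<tau>. \<Sum>i\<in>S. m \<tau> i * cell_inner x j (poly (L i)) v) has_real_derivative
        cell_inner x j mt v) (at t within J)"
      using S(2) by (auto intro!: derivative_eq_intros mt)
    then show ?thesis
      unfolding mt_def[symmetric]
      by (rule has_field_derivative_transform_within[where d=1]) (simp_all add: t ci_m)
  qed
  define d where "d \<tau> y = m \<tau> y - m t y" for \<tau> y
  have d_L: "d \<tau> y = (\<Sum>i\<in>S. d \<tau> i * poly (L i) y)" if "\<tau> \<in> J" "y \<in> cell x j" for \<tau> y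
    using L[OF mV[OF that(1)] that(2)] L[OF mV[OF t(1)] that(2)]
    by (simp add: d_def left_diff_distrib sum_subtractf)
  have dd: "cell_inner x j (d \<tau>) (d \<tau>) =
      (\<Sum>i\<in>S. d \<tau> i * (\<Sum>l\<in>S. d \<tau> l * cell_inner x j (poly (L l)) (poly (L i))))"
    if \<tau>: "\<tau> \<in> J" for \<tau>
  proof -
    have pd: "pw_poly (d \<tau>)"
      unfolding d_def using mV \<tau> t by (auto dest: dg_space_imp_pw_poly)
    have *: "cell_inner x j (d \<tau>) v = (\<Sum>i\<in>S. d \<tau> i * cell_inner x j (poly (L i)) v)"
      if "pw_poly v" for v
      using cell_inner_cong[of j "d \<tau>" "\<lambda>y. \<Sum>i\<in>S. d \<tau> i * poly (L i) y" v v, OF d_L[OF \<tau>] refl]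
        cell_inner_lincomb_left[of S "\<lambda>i. poly (L i)" v j "d \<tau>", OF S(1) pw_poly_poly that j]
      by (rule trans)
    show ?thesis
      unfolding *[OF pd] by (simp only: cell_inner_commute[of _ _ "d \<tau>"] *[OF pw_poly_poly])
  qed
  \<comment> \<open>Every summand is a product of two differentiable factors that both vanish at
    \<open>t\<close>, so the product rule gives 0.\<close>
  have "((\<lambda>\<tau>. \<Sum>i\<in>S. d \<tau> i * (\<Sum>l\<in>S. d \<tau> l * cell_inner x j (poly (L l)) (poly (L i))))
      has_real_derivative 0) (at t within J)"
    using S(2) unfolding d_def by (auto intro!: derivative_eq_intros mt)
  then show "((\<lambda>\<tau>. cell_inner x j (\<lambda>y. m \<tau> y - m t y) (\<lambda>y. m \<tau> y - m t y))
      has_real_derivative 0) (at t within J)"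
    unfolding d_def[symmetric]
    by (rule has_field_derivative_transform_within[where d=1]) (simp_all add: t dd)
qed

lemma ldg_solution_derivatives:
  assumes sol: "ldg_solution sch \<kappa> k N x J u p r m s" and t: "t \<in> J" "at t within J \<noteq> bot"
  defines "mt \<equiv> \<lambda>y. vector_derivative (\<lambda>\<tau>. m \<tau> y) (at t within J)"
  shows "((\<lambda>\<tau>. LBINT y:{x 0<..<x N}. m \<tau> y) has_real_derivative 0) (at t within J)"
    and "((\<lambda>\<tau>. energy {x 0<..<x N} (u \<tau>) (r \<tau>)) has_real_derivative 2 * mesh_inner mt (u t))
      (at t within J)"
proof -
  have V: "{u \<tau>, p \<tau>, r \<tau>, m \<tau>, s \<tau>} \<subseteq> dg_space k N x" if "\<tau> \<in> J" for \<tau>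
    using sol that by (auto simp: ldg_solution_def)
  have eqs: "ldg_equations sch \<kappa> k N x (\<lambda>y. vector_derivative (\<lambda>\<tau>. m \<tau> y) (at \<tau> within J))
      (u \<tau>) (p \<tau>) (r \<tau>) (m \<tau>) (s \<tau>)" if "\<tau> \<in> J" for \<tau>
    using sol that by (auto simp: ldg_solution_def)
  have pw: "pw_poly (u \<tau>)" "pw_poly (r \<tau>)" "pw_poly (m \<tau>)" if "\<tau> \<in> J" for \<tau>
    using V[OF that] by (auto dest: dg_space_imp_pw_poly)
  have diff: "(\<lambda>\<tau>. m \<tau> y) differentiable (at t within J)" if "j \<in> {1..N}" "y \<in> cell x j" for j y
    using sol that t by (auto simp: ldg_solution_def)
  have mV: "m \<tau> \<in> dg_space k N x" if "\<tau> \<in> J" for \<tau>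
    using V[OF that] by simp
  have inner_m: "((\<lambda>\<tau>. mesh_inner (m \<tau>) v) has_real_derivative mesh_inner mt v) (at t within J)"
    if "pw_poly v" for v
    unfolding mesh_inner_def mt_def
    by (intro DERIV_sum cell_inner_time_derivative(1)[where k=k] t that diff mV)
  have "((\<lambda>\<tau>. mesh_inner (m \<tau>) (\<lambda>y. 1)) has_real_derivative 0) (at t within J)"
    using inner_m[of "\<lambda>y. 1"] mesh_inner_mt_const[OF eqs[OF t(1)]] by (simp add: mt_def)
  then show "((\<lambda>\<tau>. LBINT y:{x 0<..<x N}. m \<tau> y) has_real_derivative 0) (at t within J)"
    by (rule has_field_derivative_transform_within[where d=1])
      (use t pw(3) in \<open>auto simp: mesh_inner_def cell_inner_def set_integral_mesh\<close>)
  define dm where "dm \<tau> y = m \<tau> y - m t y" for \<tau> y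
  define du where "du \<tau> y = u \<tau> y - u t y" for \<tau> y
  define dr where "dr \<tau> y = r \<tau> y - r t y" for \<tau> y
  let ?E = "\<lambda>\<tau>. energy {x 0<..<x N} (u \<tau>) (r \<tau>)"
  \<comment> \<open>The remainder of the energy after subtracting the part that is linear in the
    increment of \<open>m\<close>, which is differentiable.\<close>
  define \<rho> where "\<rho> \<tau> = ?E \<tau> - ?E t - 2 * (mesh_inner (m \<tau>) (u t) - mesh_inner (m t) (u t))" for \<tau>
  have E: "?E \<tau> = mesh_inner (u \<tau>) (u \<tau>) + mesh_inner (r \<tau>) (r \<tau>)" if "\<tau> \<in> J" for \<tau>
    using pw that by (simp add: energy_def l2_norm_mesh)
  have m_u: "mesh_inner (m \<sigma>) (u \<tau>) = mesh_inner (u \<sigma>) (u \<tau>) + mesh_inner (r \<sigma>) (r \<tau>)"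
    if "\<sigma> \<in> J" "\<tau> \<in> J" for \<sigma> \<tau>
    using V that by (intro mesh_inner_m[OF eqs eqs]) auto
  have squeeze: "0 \<le> \<rho> \<tau> \<and> \<rho> \<tau> \<le> mesh_inner (dm \<tau>) (dm \<tau>)" if \<tau>: "\<tau> \<in> J" for \<tau>
  proof -
    note pw' = pw[OF \<tau>] pw[OF t(1)]
    have pd: "pw_poly (dm \<tau>)" "pw_poly (du \<tau>)"
      unfolding dm_def du_def using pw' by auto
    have \<rho>: "\<rho> \<tau> = mesh_inner (du \<tau>) (du \<tau>) + mesh_inner (dr \<tau>) (dr \<tau>)"
      using E \<tau> t m_u pw' unfolding \<rho>_def du_def dr_def
      by (simp add: mesh_inner_diff_left mesh_inner_diff_right pw_poly_diff)
        (simp add: mesh_inner_commute)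
    have dm_du: "mesh_inner (dm \<tau>) (du \<tau>) = \<rho> \<tau>"
      using \<tau> t m_u pw' unfolding \<rho> dm_def du_def dr_def
      by (simp add: mesh_inner_diff_left mesh_inner_diff_right pw_poly_diff)
    \<comment> \<open>Expanding the square bounds \<open>2 * \<rho> \<tau>\<close> by the squared
      norms of \<open>dm \<tau>\<close> and \<open>du \<tau>\<close>, and the latter is at most
      \<open>\<rho> \<tau>\<close>.\<close>
    have "0 \<le> mesh_inner (\<lambda>y. dm \<tau> y - du \<tau> y) (\<lambda>y. dm \<tau> y - du \<tau> y)"
      by (rule mesh_inner_self_nonneg)
    also have "\<dots> = mesh_inner (dm \<tau>) (dm \<tau>) - 2 * \<rho> \<tau> + mesh_inner (du \<tau>) (du \<tau>)"
      using pd dm_du by (simp add: mesh_inner_diff_left mesh_inner_diff_right pw_poly_diff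
          mesh_inner_commute[of "du \<tau>" "dm \<tau>"])
    finally show ?thesis
      using \<rho> mesh_inner_self_nonneg[of "du \<tau>"] mesh_inner_self_nonneg[of "dr \<tau>"] by simp
  qed
  have "((\<lambda>\<tau>. mesh_inner (dm \<tau>) (dm \<tau>)) has_real_derivative (\<Sum>j=1..N. 0)) (at t within J)"
    unfolding mesh_inner_def dm_def
    by (intro DERIV_sum cell_inner_time_derivative(2)[where k=k] t diff mV)
  then have "(\<rho> has_real_derivative 0) (at t within J)"
    by (intro has_real_derivative_zero_squeeze[OF _ t(1) _ squeeze])
      (auto simp: dm_def mesh_inner_def cell_inner_def)
  then have "((\<lambda>\<tau>. \<rho> \<tau> + ?E t + 2 * (mesh_inner (m \<tau>) (u t) - mesh_inner (m t) (u t)))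
      has_real_derivative 2 * mesh_inner mt (u t)) (at t within J)"
    using pw t by (auto intro!: derivative_eq_intros inner_m)
  then show "(?E has_real_derivative 2 * mesh_inner mt (u t)) (at t within J)"
    by (simp add: \<rho>_def)
qed

end

theorem theorem3p1:
  fixes \<kappa> \<rho> xl xr :: real
    and k N :: nat
    and x :: "nat \<Rightarrow> real"
    and J :: "real set"
    and sch :: scheme
    and u p r m s :: "real \<Rightarrow> real \<Rightarrow> real"
  assumes "quasi_uniform_mesh \<rho> xl xr N x"
    and "is_interval J" and "interior J \<noteq> {}"
    and "ldg_solution sch \<kappa> k N x J u p r m s"
  shows "(\<forall>t\<in>J. ((\<lambda>\<tau>. LBINT y:{xl<..<xr}. m \<tau> y) has_real_derivative 0) (at t within J)) \<and>
    (sch = Dissipative \<longrightarrow>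
      (\<forall>t\<in>J. \<exists>D\<le>0.
        ((\<lambda>\<tau>. energy {xl<..<xr} (u \<tau>) (r \<tau>)) has_real_derivative D) (at t within J))) \<and>
    (sch = Conservative \<longrightarrow>
      (\<forall>t\<in>J.
        ((\<lambda>\<tau>. energy {xl<..<xr} (u \<tau>) (r \<tau>)) has_real_derivative 0) (at t within J)))"
proof -
  interpret dg_mesh N x
    using assms(1) by unfold_locales (auto simp: quasi_uniform_mesh_def)
  have ends: "x 0 = xl" "x N = xr"
    using assms(1) by (auto simp: quasi_uniform_mesh_def)
  \<comment> \<open>An interval with interior points is connected and not a singleton, so each of
    its points is a limit point; derivatives within \<open>J\<close> are then unique, also at its
    ends.\<close>
  have "at t within J \<noteq> bot" if "t \<in> J" for t
  proof -
    have "J \<noteq> {a}" for a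
      using assms(3) by auto
    then have "t islimpt J"
      by (rule connected_imp_perfect[OF is_interval_connected[OF assms(2)] that])
    then show ?thesis
      by (simp add: trivial_limit_within)
  qed
  note deriv = ldg_solution_derivatives[OF assms(4) _ this, unfolded ends]
  define mt where "mt = (\<lambda>t y. vector_derivative (\<lambda>\<tau>. m \<tau> y) (at t within J))"
  have "ldg_equations sch \<kappa> k N x (mt t) (u t) (p t) (r t) (m t) (s t)"
    "{u t, p t, r t, s t} \<subseteq> dg_space k N x" if "t \<in> J" for t
    using assms(4) that by (auto simp: ldg_solution_def mt_def)
  note mt = mesh_inner_mt_u[OF this]
  have "\<exists>D\<le>0. ((\<lambda>\<tau>. energy {xl<..<xr} (u \<tau>) (r \<tau>)) has_real_derivative D) (at t within J)"
    if "t \<in> J" for t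
    using deriv(2)[OF that that] mt(1)[OF that that]
    by (intro exI[of _ "2 * mesh_inner (mt t) (u t)"]) (simp add: mt_def)
  moreover have "((\<lambda>\<tau>. energy {xl<..<xr} (u \<tau>) (r \<tau>)) has_real_derivative 0) (at t within J)"
    if "t \<in> J" "sch = Conservative" for t
    using deriv(2)[OF that(1) that(1)] mt(2)[OF that(1) that(1) that(2)] by (simp add: mt_def)
  ultimately show ?thesis
    using deriv(1) by simp
qed

end
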